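(* Let $\alpha,\beta\in\mathbb{N}_0$ and $s\in(0,\infty)$. Then for every integer $j\neq 0$, $$\sum_{k\in\mathbb{Z}}\frac{k^{1+\alpha}(k+j)^{1+\beta}}{\sinh(k\pi/s)\,\sinh((k+j)\pi/s)}=\sum_{n=0}^{2+\alpha+\beta}a_{\alpha,\beta}(n)\,\frac{j^{1+n}}{\sinh(j\pi/s)},$$ where the coefficients $a_{\alpha,\beta}(n)$ (which do not depend on $j$) are given by $$a_{\alpha,\beta}(2+\alpha+\beta)=2(-1)^{\alpha}\frac{(1+\alpha)!\,(1+\beta)!}{(3+\alpha+\beta)!},\qquad a_{\alpha,\beta}(1+\alpha+\beta)=0,$$ and, for $0\le n\leq\alpha+\beta$, $$a_{\alpha,\beta}(n)=(-1)^{1+\alpha+\beta}\left(\binom{1+\alpha}{1+n}+(-1)^n\binom{1+\beta}{1+n}\right)e_{2+\alpha+\beta-n}+(-1)^{\alpha}\frac{s}{\pi}\delta_{\alpha,n}\delta_{\beta,0}+\frac{s}{\pi}\delta_{\beta,n}\delta_{\alpha,0},$$ with $$e_\ell=(1+(-1)^\ell)\left(\frac{B_\ell}{\ell}+2\sum_{k=1}^\infty\frac{k^{\ell-1}}{1-e^{2\pi k/s}}\right),\qquad \ell\geq 2.$$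
   Context: $\mathbb{N}_0$ is the set of nonnegative integers. In the sum over $k$, the quotients $\frac{k}{\sinh(k\pi/s)}$ at $k=0$ and $\frac{k+j}{\sinh((k+j)\pi/s)}$ at $k=-j$ are understood by their limiting value $s/\pi$ (so $\frac{k^{1+\alpha}}{\sinh(k\pi/s)}$ at $k=0$ equals $s/\pi$ if $\alpha=0$ and $0$ if $\alpha\ge1$, and similarly for the other factor). $\delta_{i,j}$ is the Kronecker delta, $B_\ell$ is the $\ell$-th Bernoulli number ($B_0=1$, $B_1=-1/2$, $B_2=1/6$, $B_4=-1/30$, ..., $B_{2n+1}=0$ for $n\ge1$), and $\binom{p}{q}=0$ for integers $q>p\ge 0$. *)

theory Defs
  imports "HOL-Analysis.Analysis"
begin

text \<open>Bernoulli numbers by the usual recursion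
  $\sum_{k=0}^{m} {m+1 \choose k} B_k = 0$ for $m \geq 1$, i.e. with the convention $B_1 = -1/2$.\<close>

fun bernoulli :: "nat \<Rightarrow> real" where
  "bernoulli 0 = 1"
| "bernoulli (Suc n) = - (\<Sum>k\<le>n. real (Suc (Suc n) choose k) * bernoulli k) / real (Suc (Suc n))"

lemma bernoulli_values:
  "bernoulli 1 = - 1 / 2" "bernoulli 2 = 1 / 6" "bernoulli 3 = 0" "bernoulli 4 = - 1 / 30"
  by (simp_all add: numeral_eq_Suc binomial_Suc_Suc)

text \<open>The quotient $x / \sinh(x \pi / s)$, extended to $x = 0$ by its limit $s / \pi$.\<close>

definition sinh_quot :: "real \<Rightarrow> real \<Rightarrow> real" where
  "sinh_quot s x = (if x = 0 then s / pi else x / sinh (x * pi / s))"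

lemma sinh_quot_limit:
  assumes "s > 0"
  shows "((\<lambda>x. x / sinh (x * pi / s)) \<longlongrightarrow> sinh_quot s 0) (at 0)"
proof -
  have "((\<lambda>x. sinh (x * pi / s)) has_real_derivative cosh (0 * pi / s) * (pi / s)) (at 0)"
    using assms by (auto intro!: derivative_eq_intros)
  then have "((\<lambda>x. sinh (x * pi / s) / x) \<longlongrightarrow> pi / s) (at 0)"
    by (simp add: has_field_derivative_iff)
  then have "((\<lambda>x. inverse (sinh (x * pi / s) / x)) \<longlongrightarrow> inverse (pi / s)) (at 0)"
    by (rule tendsto_inverse) (use assms in simp)
  then show ?thesis
    by (simp add: sinh_quot_def)
qed

text \<open>The numbers $e_\ell$ for $\ell \geq 2$; they depend on $s$.
  The series over $k \geq 1$ is indexed by $k = m + 1$ with $m \geq 0$.\<close>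

definition e_num :: "real \<Rightarrow> nat \<Rightarrow> real" where
  "e_num s l = (1 + (- 1) ^ l) *
     (bernoulli l / real l
      + 2 * (\<Sum>m. real (Suc m) ^ (l - 1) / (1 - exp (2 * pi * real (Suc m) / s))))"

text \<open>The coefficients $a_{\alpha,\beta}(n)$; only indices $n \leq 2 + \alpha + \beta$ are
  meaningful.\<close>

definition a_coeff :: "real \<Rightarrow> nat \<Rightarrow> nat \<Rightarrow> nat \<Rightarrow> real" where
  "a_coeff s \<alpha> \<beta> n =
     (if n = 2 + \<alpha> + \<beta> then
        2 * (- 1) ^ \<alpha> * (fact (1 + \<alpha>) * fact (1 + \<beta>)) / fact (3 + \<alpha> + \<beta>)
      else if n = 1 + \<alpha> + \<beta> then 0
      else
        (- 1) ^ (1 + \<alpha> + \<beta>)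
          * (real ((1 + \<alpha>) choose (1 + n)) + (- 1) ^ n * real ((1 + \<beta>) choose (1 + n)))
          * e_num s (2 + \<alpha> + \<beta> - n)
        + (- 1) ^ \<alpha> * (s / pi) * of_bool (\<alpha> = n) * of_bool (\<beta> = 0)
        + (s / pi) * of_bool (\<beta> = n) * of_bool (\<alpha> = 0))"

end

theory Submission
  imports Defs "HOL-Computational_Algebra.Polynomial"
begin

text \<open>
  The addition theorem gives $\sinh(y-x)/(\sinh x \sinh y) = \coth x - \coth y$, so multiplying the series
  by $\sinh(j\pi/s)$ turns it into a sum of $P(k) = k^{1+\alpha}(k+j)^{1+\beta}$ against a difference of
  two hyperbolic cotangents; the terms $k = 0$ and $k = -j$ account for the Kronecker deltas.
  Split $\coth(k\pi/s)$ into $\mathrm{sgn}\, k$ and an exponentially small odd tail. The tails can be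
  summed separately after a shift of $k$, and the binomial theorem produces the Lambert series in $e_\ell$.
  For $j > 0$ the signs leave the finite sum $2(-1)^\alpha \sum_{m=0}^{j} m^{1+\alpha}(j-m)^{1+\beta}$, which
  the Euler-Maclaurin formula evaluates: the integral is a Beta function and the Bernoulli terms are those
  of $e_\ell$. Negative $j$ follow from $k \mapsto -k$.
\<close>

section \<open>Euler-Maclaurin summation of polynomials\<close>

text \<open>For n >= 2 the defining recursion makes the terms below the top one cancel. For n = 1
  they leave B_0 = 1, the trace of the convention B_1 = -1/2.\<close>

lemma sum_binomial_bernoulli:
  "(\<Sum>l\<le>n. real (n choose l) * bernoulli l) = bernoulli n + of_bool (n = 1)"
proof (cases n rule: bernoulli.cases)
  case (2 m)
  then show ?thesis
    by (cases m) (simp_all add: field_simps del: binomial_Suc_Suc)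
qed simp

section \<open>Taylor expansion of polynomials\<close>

lemma higher_pderiv_pcompose_linear:
  fixes p :: "'a::idom poly"
  shows "(pderiv ^^ k) (p \<circ>\<^sub>p [:c, d:]) = smult (d ^ k) ((pderiv ^^ k) p \<circ>\<^sub>p [:c, d:])"
  by (induction k) (simp_all add: pderiv_smult pderiv_pcompose pderiv_pCons mult.commute)

lemma poly_0_higher_pderiv:
  fixes p :: "'a::field_char_0 poly"
  shows "poly ((pderiv ^^ k) p) 0 = fact k * coeff p k"
  by (simp add: poly_0_coeff_0 coeff_higher_pderiv pochhammer_fact[symmetric])

lemma poly_taylor:
  fixes p :: "'a::field_char_0 poly"
  assumes "degree p \<le> n"
  shows "poly p (x + h) = (\<Sum>r\<le>n. poly ((pderiv ^^ r) p) x / fact r * h ^ r)"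
proof -
  let ?q = "p \<circ>\<^sub>p [:x, 1:]"
  have coeff: "coeff ?q r = poly ((pderiv ^^ r) p) x / fact r" for r
    using poly_0_higher_pderiv[of r ?q]
    by (simp add: higher_pderiv_pcompose_linear poly_pcompose field_simps)
  have "poly p (x + h) = poly ?q h"
    by (simp add: poly_pcompose)
  also have "\<dots> = (\<Sum>r\<le>n. coeff ?q r * h ^ r)"
    unfolding poly_altdef using assms
    by (intro sum.mono_neutral_left) (auto simp: coeff_eq_0 degree_pcompose)
  finally show ?thesis
    by (simp add: coeff)
qed

text \<open>With D = d/dx this is the generating function identity (sum of B_l D^l / l!) (e^D - 1) =
  D, which is a finite sum on polynomials. Expanding by Taylor and collecting the total order m = l
  + r produces \<open>sum_binomial_bernoulli\<close>; the B_m cancel against the values at x and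
  only m = 1 survives.\<close>

lemma euler_maclaurin_step:
  assumes "degree g \<le> N"
  shows "(\<Sum>l\<le>N. bernoulli l / fact l *
            (poly ((pderiv ^^ l) g) (x + 1) - poly ((pderiv ^^ l) g) x)) = poly (pderiv g) x"
proof -
  define h where "h k = poly ((pderiv ^^ k) g) x" for k
  have taylor: "poly ((pderiv ^^ l) g) (x + 1) = (\<Sum>r\<le>N-l. h (l + r) / fact r)" for l
  proof -
    have "degree ((pderiv ^^ l) g) \<le> N - l"
      using assms by (simp add: degree_higher_pderiv)
    moreover have "(pderiv ^^ r) ((pderiv ^^ l) g) = (pderiv ^^ (l + r)) g" for r
      by (metis add.commute comp_apply funpow_add)
    ultimately show ?thesis
      using poly_taylor[of "(pderiv ^^ l) g" "N - l" x 1] by (simp add: h_def)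
  qed
  have "(\<Sum>l\<le>N. bernoulli l / fact l * poly ((pderiv ^^ l) g) (x + 1))
      = (\<Sum>l\<le>N. \<Sum>r\<le>N-l. bernoulli l / fact l * (h (l + r) / fact r))"
    by (simp add: taylor sum_distrib_left)
  also have "\<dots> = (\<Sum>(l, r)\<in>{(l, r). l + r \<le> N}. bernoulli l / fact l * (h (l + r) / fact r))"
    by (subst sum.Sigma) (auto intro!: sum.cong)
  also have "\<dots> = (\<Sum>m\<le>N. \<Sum>l\<le>m. bernoulli l / fact l * (h (l + (m - l)) / fact (m - l)))"
    by (rule sum.triangle_reindex_eq)
  also have "\<dots> = (\<Sum>m\<le>N. h m / fact m * (\<Sum>l\<le>m. real (m choose l) * bernoulli l))"
    by (auto simp: sum_distrib_left binomial_fact intro!: sum.cong)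
  also have "\<dots> = (\<Sum>m\<le>N. bernoulli m / fact m * h m) + (\<Sum>m\<le>N. h m / fact m * of_bool (m = 1))"
    unfolding sum_binomial_bernoulli ring_distribs sum.distrib by (simp add: mult.commute)
  also have "(\<Sum>m\<le>N. h m / fact m * of_bool (m = 1)) = (\<Sum>m\<le>N. if m = 1 then h 1 else 0)"
    by (intro sum.cong) auto
  also have "\<dots> = h 1"
  proof (cases "N = 0")
    \<comment> \<open>The index 1 lies outside the range here, but g is constant, so
      \<open>h 1\<close> is 0 as well.\<close>
    case True
    with assms have "pderiv g = 0"
      by (simp add: pderiv_eq_0_iff)
    with True show ?thesis
      by (simp add: h_def)
  qed simp
  finally show ?thesis
    by (simp add: h_def algebra_simps sum_subtractf)
qed

text \<open>Telescoping of \<open>euler_maclaurin_step\<close>. The l = 0 term is the integral of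
  the summand, and no remainder occurs because N bounds the degree of g.\<close>

lemma euler_maclaurin_poly:
  assumes "degree g \<le> N"
  shows "(\<Sum>m<n. poly (pderiv g) (real m)) =
    (\<Sum>l\<le>N. bernoulli l / fact l *
       (poly ((pderiv ^^ l) g) (real n) - poly ((pderiv ^^ l) g) 0))"
proof (induction n)
  case (Suc n)
  have "(\<Sum>m<Suc n. poly (pderiv g) (real m)) = (\<Sum>l\<le>N. bernoulli l / fact l *
       (poly ((pderiv ^^ l) g) (real n) - poly ((pderiv ^^ l) g) 0)) +
     (\<Sum>l\<le>N. bernoulli l / fact l *
            (poly ((pderiv ^^ l) g) (real n + 1) - poly ((pderiv ^^ l) g) (real n)))"
    unfolding euler_maclaurin_step[OF assms] Suc[symmetric] by simp
  also have "\<dots> = (\<Sum>l\<le>N. bernoulli l / fact l *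
       (poly ((pderiv ^^ l) g) (real (Suc n)) - poly ((pderiv ^^ l) g) 0))"
    unfolding sum.distrib[symmetric] ring_distribs[symmetric] by (simp add: add.commute)
  finally show ?case .
qed simp

section \<open>The sum $\sum_{m \le n} m^a (n-m)^b$\<close>

text \<open>The integrand of the Beta integral over [0, c]. As a polynomial it has its derivatives
  at 0 encoded in its coefficients, and the reflection x -> c - x transports them to the endpoint
  c.\<close>

definition beta_poly :: "nat \<Rightarrow> nat \<Rightarrow> real \<Rightarrow> real poly" where
  "beta_poly a b c = monom 1 a * [:c, -1:] ^ b"

lemma poly_beta_poly [simp]: "poly (beta_poly a b c) x = x ^ a * (c - x) ^ b"
  by (simp add: beta_poly_def poly_monom)

lemma beta_poly_reflect: "beta_poly b a c \<circ>\<^sub>p [:c, -1:] = beta_poly a b c"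
  by (rule poly_ext) (simp add: poly_pcompose)

lemma coeff_beta_poly:
  "coeff (beta_poly a b c) k =
     (if k < a then 0 else (-1) ^ (k - a) * real (b choose (k - a)) * c ^ (b - (k - a)))"
proof (cases "k - a \<le> b")
  case True
  then show ?thesis
    by (simp add: beta_poly_def coeff_monom_mult coeff_linear_poly_power)
next
  case False
  then have "degree ([:c, -1:] ^ b) < k - a"
    by (simp add: degree_linear_power degree_power_eq)
  with False show ?thesis
    by (simp add: beta_poly_def coeff_monom_mult coeff_eq_0)
qed

text \<open>Integration by parts lowers b while raising a, hence the induction on b with a
  arbitrary.\<close>

lemma beta_poly_antiderivative:
  obtains g where "pderiv g = beta_poly a b c" "poly g 0 = 0"
    "poly g c = fact a * fact b / fact (a + b + 1) * c ^ (a + b + 1)"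
proof -
  have "\<exists>g. pderiv g = beta_poly a b c \<and> poly g 0 = 0 \<and>
    poly g c = fact a * fact b / fact (a + b + 1) * c ^ (a + b + 1)"
  proof (induction b arbitrary: a)
    case 0
    show ?case
      by (rule exI[of _ "monom (1 / real (Suc a)) (Suc a)"])
        (simp add: pderiv_monom beta_poly_def poly_monom smult_monom fact_Suc del: of_nat_Suc)
  next
    case (Suc b)
    obtain g where g: "pderiv g = beta_poly (Suc a) b c" "poly g 0 = 0"
      "poly g c = fact (Suc a) * fact b / fact (Suc a + b + 1) * c ^ (Suc a + b + 1)"
      using Suc by blast
    \<comment> \<open>The boundary term x^(a+1) (c-x)^(b+1) vanishes at 0 and at c, so the end value
      of \<open>?h\<close> is that of g times (b+1)/(a+1).\<close>
    let ?h = "smult (1 / real (Suc a)) (beta_poly (Suc a) (Suc b) c + smult (real (Suc b)) g)"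
    have "pderiv ?h = beta_poly a (Suc b) c"
    proof (rule poly_ext)
      fix x
      have "poly (pderiv (beta_poly (Suc a) (Suc b) c)) x =
        real (Suc a) * x ^ a * (c - x) ^ Suc b - real (Suc b) * x ^ Suc a * (c - x) ^ b"
        unfolding beta_poly_def
        by (simp add: pderiv_mult pderiv_power_Suc pderiv_monom pderiv_pCons poly_monom
            algebra_simps del: power_Suc)
      then show "poly (pderiv ?h) x = poly (beta_poly a (Suc b) c) x"
        by (simp add: pderiv_smult pderiv_add g(1) field_simps)
    qed
    moreover have "poly ?h c = fact a * fact (Suc b) / fact (a + Suc b + 1) * c ^ (a + Suc b + 1)"
      by (simp add: g(3) field_simps del: of_nat_Suc)
    ultimately show ?case
      using g(2) by (intro exI[of _ ?h]) simp
  qed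
  then show ?thesis
    using that by blast
qed

text \<open>Euler-Maclaurin applied to an antiderivative of \<open>beta_poly a b n\<close>. The
  index l = 0 gives the Beta integral; for l = k + 1 the k! from the k-th derivative turns 1/(k+1)!
  into 1/(k+1).\<close>

lemma sum_beta_poly_one_sided:
  assumes "b > 0"
  shows "(\<Sum>m\<le>n. real m ^ a * (real n - real m) ^ b) =
    fact a * fact b / fact (a + b + 1) * real n ^ (a + b + 1) +
    (\<Sum>k\<le>a+b. bernoulli (Suc k) / real (Suc k) *
       ((-1) ^ k * coeff (beta_poly b a n) k - coeff (beta_poly a b n) k))"
proof -
  obtain g where g: "pderiv g = beta_poly a b (real n)" "poly g 0 = 0"
    "poly g (real n) = fact a * fact b / fact (a + b + 1) * real n ^ (a + b + 1)"
    using beta_poly_antiderivative by blast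
  have "degree (beta_poly a b (real n)) \<le> a + b"
    unfolding beta_poly_def
    by (rule order_trans[OF degree_mult_le]) (simp add: degree_monom_eq degree_power_eq)
  then have deg: "degree g \<le> Suc (a + b)"
    using degree_pderiv[of g] g(1) by simp
  \<comment> \<open>Reflection exchanges the endpoints and the exponents, and each derivative
    contributes a factor -1.\<close>
  have at_end: "poly ((pderiv ^^ k) (beta_poly a b n)) n = (-1) ^ k * (fact k * coeff (beta_poly b a n) k)" for k
    using poly_0_higher_pderiv[of k "beta_poly b a n"]
    by (simp add: higher_pderiv_pcompose_linear poly_pcompose flip: beta_poly_reflect[of b])
  have higher: "(pderiv ^^ Suc k) g = (pderiv ^^ k) (beta_poly a b n)" for k
    by (simp add: funpow_Suc_right g(1) del: funpow.simps)
  \<comment> \<open>Since b > 0, the term m = n vanishes, so the closed range may be replaced by m <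
    n.\<close>
  have "(\<Sum>m\<le>n. real m ^ a * (real n - real m) ^ b) = (\<Sum>m<n. poly (pderiv g) (real m))"
    using assms by (simp add: g(1) flip: lessThan_Suc_atMost)
  also have "\<dots> = poly g n + (\<Sum>k\<le>a+b. bernoulli (Suc k) / fact (Suc k) *
      (poly ((pderiv ^^ Suc k) g) (real n) - poly ((pderiv ^^ Suc k) g) 0))"
    unfolding euler_maclaurin_poly[OF deg] by (subst sum.atMost_Suc_shift) (simp add: g(2))
  also have "\<dots> = poly g n + (\<Sum>k\<le>a+b. bernoulli (Suc k) / real (Suc k) *
       ((-1) ^ k * coeff (beta_poly b a n) k - coeff (beta_poly a b n) k))"
    unfolding higher at_end poly_0_higher_pderiv
    by (intro arg_cong2[of _ _ _ _ "(+)"] refl sum.cong)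
      (simp_all add: divide_simps del: of_nat_Suc, simp_all add: algebra_simps)
  finally show ?thesis
    by (simp add: g(3))
qed

text \<open>Adding the one-sided formula to its mirror image under $m \mapsto n - m$ cancels the odd Bernoulli
  numbers, so their vanishing is not required.\<close>

lemma sum_beta_poly:
  "2 * (\<Sum>m\<le>n. real m ^ Suc \<alpha> * (real n - real m) ^ Suc \<beta>) =
     2 * (fact (Suc \<alpha>) * fact (Suc \<beta>) / fact (3 + \<alpha> + \<beta>)) * real n ^ (3 + \<alpha> + \<beta>) -
     (\<Sum>i\<le>\<alpha>+\<beta>. (1 + (-1) ^ (\<alpha> + \<beta> + i)) * (bernoulli (2 + \<alpha> + \<beta> - i) / real (2 + \<alpha> + \<beta> - i)) *
        ((-1) ^ (\<beta> + i) * real (Suc \<beta> choose Suc i) + (-1) ^ (\<alpha> + i) * real (Suc \<alpha> choose Suc i)) *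
        real n ^ Suc i)"
proof -
  define a b where "a = Suc \<alpha>" and "b = Suc \<beta>"
  define f f' where "f = coeff (beta_poly a b n)" and "f' = coeff (beta_poly b a n)"
  let ?T = "\<lambda>a b. \<Sum>m\<le>n. real m ^ a * (real n - real m) ^ b"
  have swap: "?T a b = ?T b a"
    by (subst sum.nat_diff_reindex[of _ "Suc n", folded lessThan_Suc_atMost, symmetric, unfolded lessThan_Suc_atMost])
       (auto intro!: sum.cong simp: of_nat_diff)
  define G where "G k = (1 + (-1) ^ Suc k) * (bernoulli (Suc k) / real (Suc k)) * (f k + f' k)" for k
  have "2 * ?T a b = ?T a b + ?T b a"
    using swap by simp
  also have "\<dots> = 2 * (fact a * fact b / fact (a + b + 1)) * real n ^ (a + b + 1) +
     (\<Sum>k\<le>a+b. bernoulli (Suc k) / real (Suc k) * ((-1) ^ k * f' k - f k)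
         + bernoulli (Suc k) / real (Suc k) * ((-1) ^ k * f k - f' k))"
    using sum_beta_poly_one_sided[of b a n] sum_beta_poly_one_sided[of a b n]
    by (simp add: a_def b_def f_def f'_def sum.distrib add.commute mult.commute
        del: of_nat_Suc fact_Suc power_Suc bernoulli.simps)
  also have "(\<Sum>k\<le>a+b. bernoulli (Suc k) / real (Suc k) * ((-1) ^ k * f' k - f k)
         + bernoulli (Suc k) / real (Suc k) * ((-1) ^ k * f k - f' k)) = - (\<Sum>k\<le>a+b. G k)"
  proof -
    have "r * (u * y - x) + r * (u * x - y) = - ((1 + - 1 * u) * r * (x + y))" for r u x y :: real
      by (simp add: algebra_simps)
    then show ?thesis
      unfolding sum_negf[symmetric] G_def power_Suc by (intro sum.cong refl)
  qed
  also have "(\<Sum>k\<le>a+b. G k) = (\<Sum>k\<in>{1..Suc (\<alpha>+\<beta>)}. G k)"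
  proof (rule sum.mono_neutral_right)
    have "G 0 = 0"
      by (simp add: G_def)
    \<comment> \<open>The two top coefficients are (-1)^b and (-1)^a: they cancel if a + b is odd,
      and otherwise the parity factor in \<open>G\<close> is 0.\<close>
    moreover have "G (a + b) = 0"
      by (cases "even a"; cases "even b") (simp_all add: G_def f_def f'_def coeff_beta_poly)
    moreover have "k = 0 \<or> k = a + b" if "k \<in> {..a + b} - {1..Suc (\<alpha>+\<beta>)}" for k
      using that by (auto simp: a_def b_def)
    ultimately show "\<forall>k\<in>{..a + b} - {1..Suc (\<alpha>+\<beta>)}. G k = 0"
      by metis
  qed (auto simp: a_def b_def)
  \<comment> \<open>Reversing the order makes i + 1 the exponent of n, as in the target
    formula.\<close>
  also have "\<dots> = (\<Sum>i\<le>\<alpha>+\<beta>. G (Suc (\<alpha> + \<beta>) - i))"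
    by (rule sum.reindex_bij_witness[of _ "\<lambda>i. Suc (\<alpha> + \<beta>) - i" "\<lambda>k. Suc (\<alpha> + \<beta>) - k"]) auto
  also have "\<dots> = (\<Sum>i\<le>\<alpha>+\<beta>. (1 + (-1) ^ (\<alpha> + \<beta> + i)) * (bernoulli (2 + \<alpha> + \<beta> - i) / real (2 + \<alpha> + \<beta> - i)) *
        ((-1) ^ (\<beta> + i) * real (Suc \<beta> choose Suc i) + (-1) ^ (\<alpha> + i) * real (Suc \<alpha> choose Suc i)) *
        real n ^ Suc i)"
  proof (intro sum.cong refl)
    fix i assume "i \<in> {..\<alpha>+\<beta>}"
    then have i: "i \<le> \<alpha> + \<beta>" by simp
    \<comment> \<open>Stated for arbitrary exponents so that exchanging them covers both
      \<open>f\<close> and \<open>f'\<close>. For i > \<beta> the index is below the lowest degree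
      and the binomial on the right vanishes too.\<close>
    have coeff: "coeff (beta_poly (Suc \<alpha>) (Suc \<beta>) n) (Suc (\<alpha> + \<beta>) - i) =
        (-1) ^ (\<beta> + i) * real (Suc \<beta> choose Suc i) * real n ^ Suc i" if "i \<le> \<alpha> + \<beta>" for \<alpha> \<beta>
    proof (cases "i \<le> \<beta>")
      case True
      then have "Suc (\<alpha> + \<beta>) - i - Suc \<alpha> = \<beta> - i" "Suc \<beta> - (\<beta> - i) = Suc i"
        "Suc \<beta> choose (\<beta> - i) = Suc \<beta> choose Suc i" "(-1::real) ^ (\<beta> - i) = (-1) ^ (\<beta> + i)"
        using binomial_symmetric[of "Suc i" "Suc \<beta>"] by (auto simp: minus_one_power_iff)
      with True show ?thesis
        by (simp add: coeff_beta_poly del: binomial_Suc_Suc)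
    next
      case False
      with that have "Suc (\<alpha> + \<beta>) - i < Suc \<alpha>" "Suc \<beta> < Suc i"
        by linarith+
      then show ?thesis
        by (simp add: coeff_beta_poly binomial_eq_0 del: binomial_Suc_Suc)
    qed
    have "Suc (Suc (\<alpha> + \<beta>) - i) = 2 + \<alpha> + \<beta> - i" "(-1::real) ^ (2 + \<alpha> + \<beta> - i) = (-1) ^ (\<alpha> + \<beta> + i)"
      using i by (auto simp: minus_one_power_iff)
    moreover have "f (Suc (\<alpha> + \<beta>) - i) = (-1) ^ (\<beta> + i) * real (Suc \<beta> choose Suc i) * real n ^ Suc i"
      using i coeff[of \<alpha> \<beta>] by (simp add: f_def a_def b_def)
    moreover have "f' (Suc (\<alpha> + \<beta>) - i) = (-1) ^ (\<alpha> + i) * real (Suc \<alpha> choose Suc i) * real n ^ Suc i"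
      using i coeff[of \<beta> \<alpha>] by (simp add: f'_def a_def b_def add.commute)
    ultimately show "G (Suc (\<alpha> + \<beta>) - i) = (1 + (-1) ^ (\<alpha> + \<beta> + i)) * (bernoulli (2 + \<alpha> + \<beta> - i) / real (2 + \<alpha> + \<beta> - i)) *
        ((-1) ^ (\<beta> + i) * real (Suc \<beta> choose Suc i) + (-1) ^ (\<alpha> + i) * real (Suc \<alpha> choose Suc i)) *
        real n ^ Suc i"
      unfolding G_def by (simp only: ring_distribs mult.assoc)
  qed
  also have "a + b + 1 = 3 + \<alpha> + \<beta>"
    by (simp add: a_def b_def)
  finally show ?thesis
    by (simp add: a_def b_def)
qed

section \<open>The hyperbolic cotangent and its moments\<close>

text \<open>Half of coth(pi x / s) - sgn x for x nonzero and s > 0. It is odd, and its value at 0 is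
  0, so k = 0 contributes nothing to the sums below.\<close>

definition coth_tail :: "real \<Rightarrow> real \<Rightarrow> real" where
  "coth_tail s x = sgn x / (exp (2 * pi * \<bar>x\<bar> / s) - 1)"

definition lambert_sum :: "real \<Rightarrow> nat \<Rightarrow> real" where
  "lambert_sum s p = (\<Sum>m. real (Suc m) ^ p / (1 - exp (2 * pi * real (Suc m) / s)))"

text \<open>The sum of k^p \<open>coth_tail s k\<close> over all integers k for s > 0. Pairing k
  with -k gives the parity factor, and the minus sign comes from 1 - exp in place of exp - 1. The
  Lambert part of \<open>e_num s (Suc p)\<close> is -2 times this number.\<close>

definition tail_moment :: "real \<Rightarrow> nat \<Rightarrow> real" where
  "tail_moment s p = - (1 + (-1) ^ Suc p) * lambert_sum s p"

lemma coth_eq_sgn_plus_tail: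
  assumes "s > 0" "x \<noteq> 0"
  shows "cosh (x * pi / s) / sinh (x * pi / s) = sgn x + 2 * coth_tail s x"
proof -
  have *: "cosh y / sinh y = 1 + 2 / (exp (2 * y) - 1)" if "y > 0" for y :: real
  proof -
    have "(u + v) / 2 / ((u - v) / 2) = (u + v) / (u - v)" for u v :: real
      by (cases "u = v") (simp_all add: field_simps)
    then have "cosh y / sinh y = (exp y + inverse (exp y)) / (exp y - inverse (exp y))"
      by (simp only: cosh_field_def sinh_field_def exp_minus)
    also have "\<dots> = (exp y * exp y + 1) / (exp y * exp y - 1)"
      using that by (simp add: divide_simps)
    also have "\<dots> = 1 + 2 / (exp y * exp y - 1)"
    proof -
      have "exp y * exp y > 1"
        using that by (simp flip: exp_add)
      then show ?thesis
        by (simp add: divide_simps)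
    qed
    finally show ?thesis
      by (simp flip: exp_add)
  qed
  show ?thesis
  proof (cases "x > 0")
    case True
    with assms *[of "x * pi / s"] show ?thesis
      by (simp add: coth_tail_def mult_ac)
  next
    case False
    with assms have "x < 0" by simp
    have "cosh (x * pi / s) / sinh (x * pi / s) = - (cosh (- x * pi / s) / sinh (- x * pi / s))"
      by simp
    also have "\<dots> = - (1 + 2 / (exp (2 * (- x * pi / s)) - 1))"
      using assms \<open>x < 0\<close> by (subst *) (simp_all add: mult_neg_pos divide_neg_pos)
    also have "\<dots> = sgn x + 2 * coth_tail s x"
      using \<open>x < 0\<close> by (simp add: coth_tail_def mult_ac)
    finally show ?thesis .
  qed
qed

lemma summable_power_div_exp_minus_1:
  assumes "c > 0"
  shows "summable (\<lambda>m. real (Suc m) ^ p / (exp (c * real (Suc m)) - 1))"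
proof (rule summable_comparison_test')
  show "summable (\<lambda>m. fact (p + 2) / c ^ (p + 2) * inverse (real (Suc m) ^ 2))"
    by (intro summable_mult) (rule summable_Suc_iff[THEN iffD2, OF inverse_power_summable], simp)
  fix m :: nat
  \<comment> \<open>Two terms of the exponential series suffice: index 0 absorbs the -1 in the
    denominator, and index p + 2 makes the terms O(1/m^2).\<close>
  have "(\<Sum>i\<in>{0, p + 2}. inverse (fact i) * (c * real (Suc m)) ^ i) \<le> exp (c * real (Suc m))"
    unfolding exp_def real_scaleR_def
    using assms by (intro sum_le_suminf summable_exp) auto
  then have le: "(c * real (Suc m)) ^ (p + 2) / fact (p + 2) \<le> exp (c * real (Suc m)) - 1"
    by (simp add: divide_inverse mult.commute)
  have pos: "(c * real (Suc m)) ^ (p + 2) / fact (p + 2) > 0"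
    using assms by simp
  have "norm (real (Suc m) ^ p / (exp (c * real (Suc m)) - 1))
      = real (Suc m) ^ p / (exp (c * real (Suc m)) - 1)"
    using order.strict_trans2[OF pos le] by (simp del: of_nat_Suc)
  also have "\<dots> \<le> real (Suc m) ^ p / ((c * real (Suc m)) ^ (p + 2) / fact (p + 2))"
    using le pos assms by (intro divide_left_mono mult_pos_pos) auto
  also have "\<dots> = fact (p + 2) / c ^ (p + 2) * inverse (real (Suc m) ^ 2)"
    using assms by (simp add: power_mult_distrib power_add power2_eq_square field_simps del: of_nat_Suc fact_Suc)
  finally show "norm (real (Suc m) ^ p / (exp (c * real (Suc m)) - 1))
      \<le> fact (p + 2) / c ^ (p + 2) * inverse (real (Suc m) ^ 2)" .
qed

lemma has_sum_tail_moment: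
  assumes "s > 0"
  shows "((\<lambda>k::int. real_of_int k ^ p * coth_tail s (real_of_int k)) has_sum tail_moment s p) UNIV"
    (is "(?f has_sum _) _")
proof -
  let ?t = "\<lambda>m. real (Suc m) ^ p / (exp (2 * pi / s * real (Suc m)) - 1)"
  have "summable ?t"
    using assms by (intro summable_power_div_exp_minus_1) simp
  moreover have "suminf ?t = - lambert_sum s p"
  proof -
    have "?t = (\<lambda>m. - (real (Suc m) ^ p / (1 - exp (2 * pi * real (Suc m) / s))))"
      by (simp add: fun_eq_iff minus_divide_right)
    with \<open>summable ?t\<close> show ?thesis
      by (simp add: lambert_sum_def suminf_minus summable_minus_iff)
  qed
  ultimately have "?t sums (- lambert_sum s p)"
    by (metis summable_sums)
  then have t: "(?t has_sum - lambert_sum s p) UNIV"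
    using assms by (intro sums_nonneg_imp_has_sum) auto
  have "(?f \<circ> (\<lambda>m. int (Suc m))) = ?t"
    by (simp add: fun_eq_iff coth_tail_def)
  then have pos: "(?f has_sum - lambert_sum s p) (range (\<lambda>m. int (Suc m)))"
    using t by (subst has_sum_reindex) (auto simp: inj_on_def)
  have "(?f \<circ> (\<lambda>m. - int (Suc m))) = (\<lambda>m. (-1) ^ Suc p * ?t m)"
    by (simp only: fun_eq_iff o_def coth_tail_def of_int_minus power_minus[of "real_of_int _"]) simp
  then have "(?f \<circ> (\<lambda>m. - int (Suc m)) has_sum (-1) ^ Suc p * - lambert_sum s p) UNIV"
    using has_sum_cmult_right[OF t] by (simp only:)
  then have neg: "(?f has_sum (-1) ^ Suc p * - lambert_sum s p) (range (\<lambda>m. - int (Suc m)))"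
    by (subst has_sum_reindex) (auto simp: inj_on_def)
  have "(?f has_sum (- lambert_sum s p + (-1) ^ Suc p * - lambert_sum s p))
     (range (\<lambda>m. int (Suc m)) \<union> range (\<lambda>m. - int (Suc m)))"
    by (intro has_sum_Un_disjoint pos neg) auto
  then have "(?f has_sum tail_moment s p) (range (\<lambda>m. int (Suc m)) \<union> range (\<lambda>m. - int (Suc m)))"
    by (simp add: tail_moment_def algebra_simps)
  also have "?this \<longleftrightarrow> ?thesis"
  proof (rule has_sum_cong_neutral)
    \<comment> \<open>Only k = 0 is missed by the positive and the negative integers.\<close>
    fix k :: int assume k: "k \<in> UNIV - (range (\<lambda>m. int (Suc m)) \<union> range (\<lambda>m. - int (Suc m)))"
    have "k = 0"
    proof (cases k rule: int_cases3)
      case (pos n)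
      with k show ?thesis
        by (cases n) auto
    next
      case (neg n)
      with k show ?thesis
        by (cases n) auto
    qed
    then show "?f k = 0"
      by (simp add: coth_tail_def)
  qed auto
  finally show ?thesis .
qed

section \<open>Sums of the tails and of the signs over all integers\<close>

lemma has_sum_sum_terms:
  fixes f :: "'a \<Rightarrow> 'b \<Rightarrow> 'c::topological_comm_monoid_add"
  assumes "\<And>i. i \<in> I \<Longrightarrow> (f i has_sum S i) A"
  shows "((\<lambda>x. \<Sum>i\<in>I. f i x) has_sum (\<Sum>i\<in>I. S i)) A"
  using assms by (induction I rule: infinite_finite_induct) (auto intro: has_sum_add)

lemma has_sum_diff_terms:
  fixes f g :: "'a \<Rightarrow> 'b::topological_ab_group_add"
  assumes "(f has_sum S) A" "(g has_sum T) A"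
  shows "((\<lambda>x. f x - g x) has_sum (S - T)) A"
  using has_sum_add[OF assms(1), of "\<lambda>x. - g x" "- T"] assms(2) by (simp add: has_sum_uminus)

text \<open>Binomial expansion of (k + c)^b. The range is extended from b to a + b, where the
  binomials vanish, so that instances with a and b exchanged share one index range.\<close>

lemma has_sum_shifted_tail_moment:
  assumes "s > 0"
  shows "((\<lambda>k::int. real_of_int k ^ a * (real_of_int k + c) ^ b * coth_tail s (real_of_int k))
    has_sum (\<Sum>i\<le>a+b. real (b choose i) * c ^ i * tail_moment s (a + b - i))) UNIV"
proof -
  have "((\<lambda>k::int. \<Sum>i\<le>b. real (b choose i) * c ^ i *
            (real_of_int k ^ (a + b - i) * coth_tail s (real_of_int k)))
    has_sum (\<Sum>i\<le>b. real (b choose i) * c ^ i * tail_moment s (a + b - i))) UNIV"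
    by (intro has_sum_sum_terms has_sum_cmult_right has_sum_tail_moment assms)
  also have "(\<Sum>i\<le>b. real (b choose i) * c ^ i * tail_moment s (a + b - i)) =
     (\<Sum>i\<le>a+b. real (b choose i) * c ^ i * tail_moment s (a + b - i))"
    by (intro sum.mono_neutral_left) auto
  also have "(\<lambda>k::int. \<Sum>i\<le>b. real (b choose i) * c ^ i *
            (real_of_int k ^ (a + b - i) * coth_tail s (real_of_int k)))
     = (\<lambda>k. real_of_int k ^ a * (real_of_int k + c) ^ b * coth_tail s (real_of_int k))"
  proof
    fix k :: int
    have "(real_of_int k + c) ^ b = (\<Sum>i\<le>b. real (b choose i) * c ^ i * real_of_int k ^ (b - i))"
      by (subst add.commute, subst binomial_ring) (rule refl)
    then show "(\<Sum>i\<le>b. real (b choose i) * c ^ i *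
            (real_of_int k ^ (a + b - i) * coth_tail s (real_of_int k)))
     = real_of_int k ^ a * (real_of_int k + c) ^ b * coth_tail s (real_of_int k)"
      by (auto simp: sum_distrib_left sum_distrib_right power_add mult_ac
          simp flip: add_diff_assoc intro!: sum.cong)
  qed
  finally show ?thesis .
qed

text \<open>Both tails are summable on their own, so the second can be recentred by a shift of k by
  j; this turns j into -j and accounts for the sign (-1)^i.\<close>

lemma has_sum_tail_difference:
  fixes j :: int
  assumes "s > 0"
  shows "((\<lambda>k. real_of_int k ^ Suc \<alpha> * real_of_int (k + j) ^ Suc \<beta> *
              (coth_tail s (real_of_int k) - coth_tail s (real_of_int (k + j)))) has_sum
     (\<Sum>i\<le>\<alpha>+\<beta>. (real (Suc \<beta> choose Suc i) + (-1) ^ i * real (Suc \<alpha> choose Suc i)) *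
        real_of_int j ^ Suc i * tail_moment s (Suc (\<alpha> + \<beta>) - i))) UNIV"
proof -
  define c where "c i = real (Suc \<beta> choose i) * real_of_int j ^ i -
     real (Suc \<alpha> choose i) * (- real_of_int j) ^ i" for i
  define M where "M i = c i * tail_moment s (Suc (Suc (\<alpha> + \<beta>)) - i)" for i
  have 1: "((\<lambda>k. real_of_int k ^ Suc \<alpha> * real_of_int (k + j) ^ Suc \<beta> * coth_tail s (real_of_int k))
     has_sum (\<Sum>i\<le>Suc (Suc (\<alpha>+\<beta>)). real (Suc \<beta> choose i) * real_of_int j ^ i *
        tail_moment s (Suc (Suc (\<alpha> + \<beta>)) - i))) UNIV"
    using has_sum_shifted_tail_moment[OF assms, of "Suc \<alpha>" "real_of_int j" "Suc \<beta>"] by simp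
  let ?g = "\<lambda>k. real_of_int (k - j) ^ Suc \<alpha> * real_of_int k ^ Suc \<beta> * coth_tail s (real_of_int k)"
  have "(?g has_sum (\<Sum>i\<le>Suc (Suc (\<alpha>+\<beta>)). real (Suc \<alpha> choose i) * (- real_of_int j) ^ i *
        tail_moment s (Suc (Suc (\<alpha> + \<beta>)) - i))) UNIV"
    using has_sum_shifted_tail_moment[OF assms, of "Suc \<beta>" "- real_of_int j" "Suc \<alpha>"]
    by (simp add: mult_ac add_ac)
  then have "((\<lambda>k. ?g (k + j)) has_sum (\<Sum>i\<le>Suc (Suc (\<alpha>+\<beta>)). real (Suc \<alpha> choose i) * (- real_of_int j) ^ i *
        tail_moment s (Suc (Suc (\<alpha> + \<beta>)) - i))) UNIV"
    by (subst has_sum_reindex_bij_betw[of "\<lambda>k. k + j" UNIV UNIV ?g])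
      (auto intro!: bij_betwI[of _ _ _ "\<lambda>k. k - j"])
  from has_sum_diff_terms[OF 1 this]
  have "((\<lambda>k. real_of_int k ^ Suc \<alpha> * real_of_int (k + j) ^ Suc \<beta> *
              (coth_tail s (real_of_int k) - coth_tail s (real_of_int (k + j)))) has_sum
     (\<Sum>i\<le>Suc (Suc (\<alpha>+\<beta>)). M i)) UNIV"
    by (simp only: M_def c_def ring_distribs sum_subtractf add_diff_cancel_right')
  also have "(\<Sum>i\<le>Suc (Suc (\<alpha>+\<beta>)). M i) = (\<Sum>i\<le>\<alpha>+\<beta>. M (Suc i))"
  proof -
    \<comment> \<open>At index 0 the two binomial terms are both 1 and cancel; at the top index both
      binomials are 0.\<close>
    have "M 0 = 0" "M (Suc (Suc (\<alpha>+\<beta>))) = 0"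
      by (simp_all add: M_def c_def binomial_eq_0 del: binomial_Suc_Suc)
    then show ?thesis
      by (subst sum.atMost_Suc_shift) simp
  qed
  also have "\<dots> = (\<Sum>i\<le>\<alpha>+\<beta>. (real (Suc \<beta> choose Suc i) + (-1) ^ i * real (Suc \<alpha> choose Suc i)) *
        real_of_int j ^ Suc i * tail_moment s (Suc (\<alpha> + \<beta>) - i))"
    by (intro sum.cong)
      (simp_all add: M_def c_def power_minus[of "real_of_int j"] algebra_simps del: binomial_Suc_Suc)
  finally show ?thesis .
qed

text \<open>The signs differ only for -n <= k <= 0. With k = -m the interior difference is -2, which
  together with (-m)^(1+\<alpha>) gives 2 (-1)^\<alpha>.\<close>

lemma has_sum_sgn_difference:
  "((\<lambda>k. real_of_int k ^ Suc \<alpha> * real_of_int (k + int n) ^ Suc \<beta> *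
        (sgn (real_of_int k) - sgn (real_of_int (k + int n)))) has_sum
    (-1) ^ \<alpha> * (2 * (\<Sum>m\<le>n. real m ^ Suc \<alpha> * (real n - real m) ^ Suc \<beta>))) UNIV"
proof (rule has_sum_finite_neutralI)
  let ?B = "(\<lambda>m. - int m) ` {..n}"
  fix k :: int assume k: "k \<in> UNIV - ?B"
  have "k > 0 \<or> k + int n < 0"
  proof (rule ccontr)
    assume "\<not> ?thesis"
    then have "k = - int (nat (- k))" "nat (- k) \<in> {..n}"
      by auto
    with k show False
      by blast
  qed
  then show "real_of_int k ^ Suc \<alpha> * real_of_int (k + int n) ^ Suc \<beta> *
        (sgn (real_of_int k) - sgn (real_of_int (k + int n))) = 0"
    by (auto simp: sgn_if)
next
  have *: "real_of_int (- int m) ^ Suc \<alpha> * real_of_int (- int m + int n) ^ Suc \<beta> *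
        (sgn (real_of_int (- int m)) - sgn (real_of_int (- int m + int n)))
     = (-1) ^ \<alpha> * (2 * (real m ^ Suc \<alpha> * (real n - real m) ^ Suc \<beta>))" if "m \<le> n" for m
  \<comment> \<open>At the endpoints the sign difference is not -2, but one of the powers is 0
    there.\<close>
  proof (cases "m = 0 \<or> m = n")
    case False
    with that have "sgn (real_of_int (- int m)) = -1" "sgn (real_of_int (- int m + int n)) = 1"
      by (auto simp: sgn_if)
    then show ?thesis
      by (simp add: power_minus[of "real m"])
  qed auto
  show "(-1) ^ \<alpha> * (2 * (\<Sum>m\<le>n. real m ^ Suc \<alpha> * (real n - real m) ^ Suc \<beta>)) =
    (\<Sum>k\<in>(\<lambda>m. - int m) ` {..n}. real_of_int k ^ Suc \<alpha> * real_of_int (k + int n) ^ Suc \<beta> *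
        (sgn (real_of_int k) - sgn (real_of_int (k + int n))))"
    unfolding sum_distrib_left
    by (subst sum.reindex, simp add: inj_on_def, unfold o_def, intro sum.cong refl *[symmetric])
      (simp only: atMost_iff)
qed auto

section \<open>The convolution sum\<close>

lemma sinh_quot_minus [simp]: "sinh_quot s (- x) = sinh_quot s x"
  by (simp add: sinh_quot_def)

text \<open>Away from k = 0 and k = -j this is sinh(v-u)/(sinh u sinh v) = coth u - coth v. At these
  two points the powers kill the first two terms, while the limit value of \<open>sinh_quot\<close>
  leaves s/pi when the exponent is 0; the last two terms record this.\<close>

lemma summand_decomposition:
  fixes j k :: int
  assumes "s > 0" "j \<noteq> 0"
  defines "x \<equiv> real_of_int k" and "y \<equiv> real_of_int (k + j)" and "z \<equiv> real_of_int j"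
  shows "sinh (z * pi / s) * ((x ^ \<alpha> * sinh_quot s x) * (y ^ \<beta> * sinh_quot s y)) =
    x ^ Suc \<alpha> * y ^ Suc \<beta> * (sgn x - sgn y) +
    2 * (x ^ Suc \<alpha> * y ^ Suc \<beta> * (coth_tail s x - coth_tail s y)) +
    (if k = 0 then s / pi * of_bool (\<alpha> = 0) * z ^ Suc \<beta> else 0) +
    (if k = - j then (-1) ^ \<alpha> * (s / pi) * of_bool (\<beta> = 0) * z ^ Suc \<alpha> else 0)"
proof -
  have nz: "sinh (r * pi / s) \<noteq> 0" if "r \<noteq> 0" for r
    using that assms(1) by simp
  consider "k = 0" | "k = - j" | "x \<noteq> 0" "y \<noteq> 0" "k \<noteq> 0" "k \<noteq> - j"
    unfolding x_def y_def by linarith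
  then show ?thesis
  proof cases
    case 1
    then have "x = 0" "y = z" "z \<noteq> 0"
      using assms by (auto simp: x_def y_def z_def)
    with 1 nz[of z] \<open>j \<noteq> 0\<close> show ?thesis
      by (simp add: sinh_quot_def power_0_left)
  next
    case 2
    then have "x = - z" "y = 0" "z \<noteq> 0"
      using assms by (auto simp: x_def y_def z_def)
    with 2 nz[of z] \<open>j \<noteq> 0\<close> show ?thesis
      by (simp add: sinh_quot_def power_0_left power_minus[of z])
  next
    case 3
    have z: "z = y - x"
      by (simp add: x_def y_def z_def)
    have "sinh (z * pi / s) = sinh (y * pi / s - x * pi / s)"
      by (simp add: z left_diff_distrib diff_divide_distrib)
    \<comment> \<open>Here X, Y stand for the hyperbolic sines at x and y, a, b for the cosines, and
      p, q for the powers of x and y.\<close>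
    moreover have "(Y * a - b * X) * ((p * (x / X)) * (q * (y / Y))) = p * x * (q * y) * (a / X - b / Y)"
      if "X \<noteq> 0" "Y \<noteq> 0" for a b p q X Y :: real
      using that by (simp add: field_simps)
    ultimately have "sinh (z * pi / s) * ((x ^ \<alpha> * sinh_quot s x) * (y ^ \<beta> * sinh_quot s y)) =
      x ^ Suc \<alpha> * y ^ Suc \<beta> * (cosh (x * pi / s) / sinh (x * pi / s) - cosh (y * pi / s) / sinh (y * pi / s))"
      using 3 nz[of x] nz[of y]
      by (simp add: sinh_quot_def sinh_diff mult.commute[of _ x] mult.commute[of _ y])
    also have "\<dots> = x ^ Suc \<alpha> * y ^ Suc \<beta> * (sgn x - sgn y) +
      2 * (x ^ Suc \<alpha> * y ^ Suc \<beta> * (coth_tail s x - coth_tail s y))"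
      unfolding coth_eq_sgn_plus_tail[OF \<open>s > 0\<close> 3(1)] coth_eq_sgn_plus_tail[OF \<open>s > 0\<close> 3(2)]
      by (simp add: algebra_simps)
    finally show ?thesis
      using 3 by simp
  qed
qed

text \<open>Splits the coefficient by origin: tail moments, Bernoulli terms from Euler-Maclaurin,
  and the two exceptional points. The first two carry the same parity factor, so fixing the parities
  of \<alpha>, \<beta> and i reduces the claim to matching signs.\<close>

lemma a_coeff_le:
  assumes "i \<le> \<alpha> + \<beta>"
  shows "a_coeff s \<alpha> \<beta> i =
    2 * (real (Suc \<beta> choose Suc i) + (-1) ^ i * real (Suc \<alpha> choose Suc i)) * tail_moment s (Suc (\<alpha> + \<beta>) - i)
    - (-1) ^ \<alpha> * ((1 + (-1) ^ (\<alpha> + \<beta> + i)) * (bernoulli (2 + \<alpha> + \<beta> - i) / real (2 + \<alpha> + \<beta> - i)) *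
        ((-1) ^ (\<beta> + i) * real (Suc \<beta> choose Suc i) + (-1) ^ (\<alpha> + i) * real (Suc \<alpha> choose Suc i)))
    + (if i = \<alpha> then (-1) ^ \<alpha> * (s / pi) * of_bool (\<beta> = 0) else 0)
    + (if i = \<beta> then s / pi * of_bool (\<alpha> = 0) else 0)"
proof -
  define l where "l = Suc (\<alpha> + \<beta>) - i"
  have l: "2 + \<alpha> + \<beta> - i = Suc l" "Suc (\<alpha> + \<beta>) - i = l" "l + i = Suc (\<alpha> + \<beta>)"
    using assms by (auto simp: l_def)
  have i: "i \<noteq> 2 + \<alpha> + \<beta>" "i \<noteq> 1 + \<alpha> + \<beta>"
    using assms by auto
  have par: "even l \<longleftrightarrow> odd (\<alpha> + \<beta> + i)"
    using l(3) by presburger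
  define R where "R = bernoulli (Suc l) / real (Suc l)"
  show ?thesis
    unfolding a_coeff_def if_not_P[OF i(1)] if_not_P[OF i(2)] e_num_def l tail_moment_def R_def[symmetric]
      lambert_sum_def[symmetric] diff_Suc_1
    using par
    by (cases "even \<alpha>"; cases "even \<beta>"; cases "even i")
      (auto simp: algebra_simps simp del: binomial_Suc_Suc bernoulli.simps)
qed

lemma has_sum_sinh_quot_convolution_pos:
  assumes "s > 0" "n > 0"
  shows "((\<lambda>k::int. (real_of_int k ^ \<alpha> * sinh_quot s (real_of_int k))
              * (real_of_int (k + int n) ^ \<beta> * sinh_quot s (real_of_int (k + int n))))
           has_sum
          (\<Sum>i = 0..2 + \<alpha> + \<beta>. a_coeff s \<alpha> \<beta> i * (real n ^ (1 + i) / sinh (real n * pi / s)))) UNIV"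
    (is "(?f has_sum _) _")
proof -
  let ?c = "sinh (real n * pi / s)"
  let ?V = "(-1) ^ \<alpha> * (2 * (\<Sum>m\<le>n. real m ^ Suc \<alpha> * (real n - real m) ^ Suc \<beta>)) +
    2 * (\<Sum>i\<le>\<alpha>+\<beta>. (real (Suc \<beta> choose Suc i) + (-1) ^ i * real (Suc \<alpha> choose Suc i)) *
        real n ^ Suc i * tail_moment s (Suc (\<alpha> + \<beta>) - i)) +
    s / pi * of_bool (\<alpha> = 0) * real n ^ Suc \<beta> +
    (-1) ^ \<alpha> * (s / pi) * of_bool (\<beta> = 0) * real n ^ Suc \<alpha>"
  \<comment> \<open>Writes each exceptional term as a sum supported at one integer.\<close>
  have single: "((\<lambda>k. if k = k0 then C else 0) has_sum C) UNIV" for k0 :: int and C :: real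
    by (rule has_sum_finite_neutralI[of "{k0}"]) auto
  have "((\<lambda>k. ?c * ?f k) has_sum ?V) UNIV"
    using summand_decomposition[OF \<open>s > 0\<close>, of "int n"] \<open>n > 0\<close>
      has_sum_add[OF has_sum_add[OF has_sum_add[OF has_sum_sgn_difference[of \<alpha> n \<beta>]
         has_sum_cmult_right[OF has_sum_tail_difference[OF \<open>s > 0\<close>, of \<alpha> "int n" \<beta>], of 2]]
         single[of 0 "s / pi * of_bool (\<alpha> = 0) * real n ^ Suc \<beta>"]]
         single[of "- int n" "(-1) ^ \<alpha> * (s / pi) * of_bool (\<beta> = 0) * real n ^ Suc \<alpha>"]]
    by (simp only: of_int_of_nat_eq of_nat_eq_0_iff neq0_conv)
  \<comment> \<open>Comparison of powers of n: the Beta integral gives the top coefficient, the one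
    below it is 0, and \<open>a_coeff_le\<close> handles the rest.\<close>
  also have "?V = (\<Sum>i = 0..2 + \<alpha> + \<beta>. a_coeff s \<alpha> \<beta> i * real n ^ (1 + i))"
  proof -
    let ?\<delta> = "\<lambda>i. (if i = \<alpha> then (-1) ^ \<alpha> * (s / pi) * of_bool (\<beta> = 0) else 0)"
    let ?\<delta>' = "\<lambda>i. (if i = \<beta> then s / pi * of_bool (\<alpha> = 0) else 0)"
    let ?b = "\<lambda>i. (1 + (-1) ^ (\<alpha> + \<beta> + i)) * (bernoulli (2 + \<alpha> + \<beta> - i) / real (2 + \<alpha> + \<beta> - i)) *
        ((-1) ^ (\<beta> + i) * real (Suc \<beta> choose Suc i) + (-1) ^ (\<alpha> + i) * real (Suc \<alpha> choose Suc i))"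
    let ?t = "\<lambda>i. (real (Suc \<beta> choose Suc i) + (-1) ^ i * real (Suc \<alpha> choose Suc i)) *
        real n ^ Suc i * tail_moment s (Suc (\<alpha> + \<beta>) - i)"
    have "(\<Sum>i = 0..2 + \<alpha> + \<beta>. a_coeff s \<alpha> \<beta> i * real n ^ (1 + i)) =
      (\<Sum>i\<le>\<alpha>+\<beta>. a_coeff s \<alpha> \<beta> i * real n ^ Suc i) +
      a_coeff s \<alpha> \<beta> (1 + \<alpha> + \<beta>) * real n ^ (2 + \<alpha> + \<beta>) +
      a_coeff s \<alpha> \<beta> (2 + \<alpha> + \<beta>) * real n ^ (3 + \<alpha> + \<beta>)"
      unfolding atMost_atLeast0[symmetric] by (simp add: numeral_eq_Suc)
    also have "a_coeff s \<alpha> \<beta> (1 + \<alpha> + \<beta>) = 0"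
      by (simp add: a_coeff_def)
    also have "a_coeff s \<alpha> \<beta> (2 + \<alpha> + \<beta>) =
        (-1) ^ \<alpha> * (2 * (fact (Suc \<alpha>) * fact (Suc \<beta>) / fact (3 + \<alpha> + \<beta>)))"
      by (simp add: a_coeff_def del: fact_Suc)
    also have "(\<Sum>i\<le>\<alpha>+\<beta>. a_coeff s \<alpha> \<beta> i * real n ^ Suc i) =
       (\<Sum>i\<le>\<alpha>+\<beta>. 2 * ?t i - (-1) ^ \<alpha> * (?b i * real n ^ Suc i) +
          ?\<delta> i * real n ^ Suc i + ?\<delta>' i * real n ^ Suc i)"
      by (intro sum.cong refl, subst a_coeff_le) (simp_all only: atMost_iff ring_distribs mult_ac)
    also have "\<dots> = 2 * (\<Sum>i\<le>\<alpha>+\<beta>. ?t i) - (-1) ^ \<alpha> * (\<Sum>i\<le>\<alpha>+\<beta>. ?b i * real n ^ Suc i) +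
       (\<Sum>i\<le>\<alpha>+\<beta>. ?\<delta> i * real n ^ Suc i) + (\<Sum>i\<le>\<alpha>+\<beta>. ?\<delta>' i * real n ^ Suc i)"
      by (simp only: sum.distrib sum_subtractf sum_distrib_left)
    also have "(\<Sum>i\<le>\<alpha>+\<beta>. ?\<delta> i * real n ^ Suc i) = (-1) ^ \<alpha> * (s / pi) * of_bool (\<beta> = 0) * real n ^ Suc \<alpha>"
      by (subst sum.mono_neutral_right[of _ "{\<alpha>}"]) auto
    also have "(\<Sum>i\<le>\<alpha>+\<beta>. ?\<delta>' i * real n ^ Suc i) = s / pi * of_bool (\<alpha> = 0) * real n ^ Suc \<beta>"
      by (subst sum.mono_neutral_right[of _ "{\<beta>}"]) auto
    finally show ?thesis
      unfolding sum_beta_poly by (simp only: ring_distribs mult_ac add_ac mult_zero_left diff_conv_add_uminus)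
  qed
  finally have "((\<lambda>k. inverse ?c * (?c * ?f k)) has_sum
     inverse ?c * (\<Sum>i = 0..2 + \<alpha> + \<beta>. a_coeff s \<alpha> \<beta> i * real n ^ (1 + i))) UNIV"
    by (rule has_sum_cmult_right)
  moreover have "inverse ?c * (?c * r) = r" for r
    using assms by simp
  ultimately show ?thesis
    by (simp only: sum_distrib_left divide_inverse mult_ac)
qed

text \<open>The coefficient vanishes unless i and \<alpha> + \<beta> have equal parity: otherwise
  the factor of \<open>e_num\<close> is 0, and each Kronecker product would force i = \<alpha> +
  \<beta>. This is what carries the formula over to negative j.\<close>

lemma a_coeff_parity:
  assumes "i \<le> 2 + \<alpha> + \<beta>"
  shows "(-1) ^ (\<alpha> + \<beta>) * a_coeff s \<alpha> \<beta> i = (-1) ^ i * a_coeff s \<alpha> \<beta> i"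
proof (cases "even (\<alpha> + \<beta> + i)")
  case True
  then have "even (\<alpha> + \<beta>) = even i"
    by simp
  then show ?thesis
    by (simp only: minus_one_power_iff)
next
  case False
  then have "i \<noteq> 2 + \<alpha> + \<beta>" and "odd (2 + \<alpha> + \<beta> - i)"
    using assms by (auto simp: even_diff_nat)
  moreover have "\<not> (\<alpha> = i \<and> \<beta> = 0)" "\<not> (\<beta> = i \<and> \<alpha> = 0)"
    using False by (auto dest: odd_pos)
  ultimately have "a_coeff s \<alpha> \<beta> i = 0"
    by (auto simp: a_coeff_def e_num_def)
  then show ?thesis
    by simp
qed

theorem theorem2p1:
  fixes \<alpha> \<beta> :: nat and s :: real and j :: int
  assumes "s > 0" and "j \<noteq> 0"
  shows "((\<lambda>k::int. (real_of_int k ^ \<alpha> * sinh_quot s (real_of_int k))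
              * (real_of_int (k + j) ^ \<beta> * sinh_quot s (real_of_int (k + j))))
           has_sum
          (\<Sum>n = 0..2 + \<alpha> + \<beta>. a_coeff s \<alpha> \<beta> n
              * (real_of_int j ^ (1 + n) / sinh (real_of_int j * pi / s)))) UNIV"
proof (cases "j > 0")
  case True
  then obtain m where "j = int m" "m > 0"
    using zero_less_imp_eq_int by blast
  with has_sum_sinh_quot_convolution_pos[OF \<open>s > 0\<close>, of m] show ?thesis
    by simp
next
  case False
  with assms obtain m where m: "- j = int m" "m > 0"
    using zero_less_imp_eq_int[of "- j"] by auto
  then have j: "j = - int m"
    by simp
  let ?f = "\<lambda>j k::int. (real_of_int k ^ \<alpha> * sinh_quot s (real_of_int k))
              * (real_of_int (k + j) ^ \<beta> * sinh_quot s (real_of_int (k + j)))"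
  let ?R = "\<lambda>j. \<Sum>n = 0..2 + \<alpha> + \<beta>. a_coeff s \<alpha> \<beta> n * (j ^ (1 + n) / sinh (j * pi / s))"
  have "((\<lambda>k. (-1) ^ (\<alpha> + \<beta>) * ?f (int m) k) has_sum (-1) ^ (\<alpha> + \<beta>) * ?R (real m)) UNIV"
    by (intro has_sum_cmult_right has_sum_sinh_quot_convolution_pos \<open>s > 0\<close> \<open>m > 0\<close>)
  then have "((\<lambda>k. (-1) ^ (\<alpha> + \<beta>) * ?f (int m) (- k)) has_sum (-1) ^ (\<alpha> + \<beta>) * ?R (real m)) UNIV"
    by (subst has_sum_reindex_bij_betw[of uminus UNIV UNIV "\<lambda>k. (-1) ^ (\<alpha> + \<beta>) * ?f (int m) k"])
      (auto intro!: bij_betwI[of _ _ _ uminus])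
  \<comment> \<open>Under k -> -k both arguments change sign; \<open>sinh_quot\<close> is even, so
    only the powers contribute, namely (-1)^(\<alpha>+\<beta>).\<close>
  also have "(\<lambda>k. (-1) ^ (\<alpha> + \<beta>) * ?f (int m) (- k)) = ?f j"
  proof
    fix k :: int
    have "real_of_int (- k + int m) = - real_of_int (k + j)"
      by (simp add: j)
    moreover have "(-1) ^ (\<alpha> + \<beta>) * ((((-1) ^ \<alpha> * x) * u) * (((-1) ^ \<beta> * y) * v)) = x * u * (y * v)"
      for x y u v :: real
      by (cases "even \<alpha>"; cases "even \<beta>") simp_all
    ultimately show "(-1) ^ (\<alpha> + \<beta>) * ?f (int m) (- k) = ?f j k"
      by (simp only: of_int_minus sinh_quot_minus power_minus[of "real_of_int _"])
  qed
  \<comment> \<open>Passing from m to -m multiplies the i-th quotient by (-1)^i, which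
    \<open>a_coeff_parity\<close> exchanges for (-1)^(\<alpha>+\<beta>).\<close>
  also have "(-1) ^ (\<alpha> + \<beta>) * ?R (real m) = ?R (real_of_int j)"
    unfolding sum_distrib_left
  proof (intro sum.cong refl)
    fix i assume "i \<in> {0..2 + \<alpha> + \<beta>}"
    then have "(-1) ^ (\<alpha> + \<beta>) * (a_coeff s \<alpha> \<beta> i * (real m ^ (1 + i) / sinh (real m * pi / s))) =
       (-1) ^ i * a_coeff s \<alpha> \<beta> i * (real m ^ (1 + i) / sinh (real m * pi / s))"
      using a_coeff_parity[of i \<alpha> \<beta> s] by (simp only: mult.assoc[symmetric] atLeastAtMost_iff)
    also have "\<dots> = a_coeff s \<alpha> \<beta> i * (real_of_int j ^ (1 + i) / sinh (real_of_int j * pi / s))"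
      by (simp add: j power_minus[of "real m"])
    finally show "(-1) ^ (\<alpha> + \<beta>) * (a_coeff s \<alpha> \<beta> i * (real m ^ (1 + i) / sinh (real m * pi / s))) =
       a_coeff s \<alpha> \<beta> i * (real_of_int j ^ (1 + i) / sinh (real_of_int j * pi / s))" .
  qed
  finally show ?thesis .
qed

end
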